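(* Let $k$ be a positive integer and let $G$ be a graph with minimum degree $\delta(G)$ at least $k-1$. Then $d_{\times k}(G)=\left\lfloor\frac{\delta(G)+1}{k}\right\rfloor$ if and only if $G\in\Omega$, where $\Omega$ is the family of graphs (for the given $k$) described in the context.
   Context: All graphs are finite and simple. $N[v]=N(v)\cup\{v\}$ is the closed neighborhood of $v$, and $\delta(G)$ is the minimum degree of $G$. For a graph $G$ with $\delta(G)\ge k-1$, a set $S\subseteq V(G)$ is a $k$-tuple dominating set ($k$TD set) if $|N[v]\cap S|\ge k$ for each $v\in V(G)$. The $k$-tuple domatic number $d_{\times k}(G)$ is the maximum number of sets in a vertex partition of $G$ into $k$TD sets. The family $\Omega$ (depending on $k$): let $q$ be a positive integer. By the division algorithm, there exist unique integers $t$ and $r$ satisfying $q+1=tk+r$ and $0\le r\le k-1$. Begin with $t$ arbitrary graphs $H_1,\dots,H_t$ (on disjoint vertex sets) with $\delta(H_i)\ge k-1$ for each $1\le i\le t$, and $\delta(H_{i'})\le 2k-2$ for some $1\le i'\le t$. Next add some edges with one end point in $V(H_i)$ and the other in $V(H_j)$ (for distinct $i,j$) in such a way that (i) the minimum degree of the resulting graph equals $q$, and (ii) every vertex of $H_i$ has at least $k$ neighbors in $H_j$ for each $1\le i\ne j\le t$. $\Omega$ is the family of all graphs constructed in this way.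
   Formalization: The family Ω is taken with q a non-negative integer instead of a positive one, since for k = 1 and G = K_1 (δ(G) = 0) the equality holds while no member of Ω with positive q has minimum degree 0; graphs are assumed to have at least one vertex. *)

theory Defs
  imports "Graph_Theory.Pair_Digraph" "HOL-Library.Disjoint_Sets"
begin

text \<open>
  An undirected edge \<open>{u, v}\<close> is represented by the two arcs \<open>(u, v)\<close> and \<open>(v, u)\<close>;
  \<^const>\<open>pair_graph\<close> says that the arc relation is finite, symmetric and loop-free. Graphs have
  at least one vertex, so that the minimum degree is defined.
\<close>

definition simple_graph :: "'a pair_pre_digraph \<Rightarrow> bool" where
  "simple_graph G \<longleftrightarrow> pair_graph G \<and> pverts G \<noteq> {}"

definition nbhd :: "'a pair_pre_digraph \<Rightarrow> 'a \<Rightarrow> 'a set" where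
  "nbhd G v = {u. (v, u) \<in> parcs G}"

definition closed_nbhd :: "'a pair_pre_digraph \<Rightarrow> 'a \<Rightarrow> 'a set" where
  "closed_nbhd G v = nbhd G v \<union> {v}"

definition min_degree :: "'a pair_pre_digraph \<Rightarrow> nat" where
  "min_degree G = Min ((\<lambda>v. card (nbhd G v)) ` pverts G)"

definition k_tuple_dominating :: "nat \<Rightarrow> 'a pair_pre_digraph \<Rightarrow> 'a set \<Rightarrow> bool" where
  "k_tuple_dominating k G S \<longleftrightarrow>
     S \<subseteq> pverts G \<and> (\<forall>v \<in> pverts G. k \<le> card (closed_nbhd G v \<inter> S))"

text \<open>
  Meaningful for a graph with \<open>min_degree G \<ge> k - 1\<close>: the set below is then finite and
  contains 1, because the whole vertex set is a \<open>k\<close>-tuple dominating set.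
\<close>

definition k_tuple_domatic_number :: "nat \<Rightarrow> 'a pair_pre_digraph \<Rightarrow> nat" where
  "k_tuple_domatic_number k G =
     Max {card P | P. partition_on (pverts G) P \<and> (\<forall>S \<in> P. k_tuple_dominating k G S)}"

text \<open>
  \<open>omega_construction k q t H A G\<close>: the graph \<open>G\<close> with minimum degree \<open>q\<close> arises from the disjoint
  graphs \<open>H 1, \<dots>, H t\<close> by adding the set \<open>A\<close> of edges between different \<open>H i\<close>.
\<close>

definition omega_construction ::
  "nat \<Rightarrow> nat \<Rightarrow> nat \<Rightarrow> (nat \<Rightarrow> 'a pair_pre_digraph) \<Rightarrow> 'a rel \<Rightarrow> 'a pair_pre_digraph \<Rightarrow> bool" where
  "omega_construction k q t H A G \<longleftrightarrow>
     (\<forall>i \<in> {1..t}. simple_graph (H i) \<and> min_degree (H i) \<ge> k - 1) \<and>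
     disjoint_family_on (\<lambda>i. pverts (H i)) {1..t} \<and>
     (\<exists>i \<in> {1..t}. min_degree (H i) \<le> 2 * k - 2) \<and>
     sym A \<and>
     (\<forall>(u, v) \<in> A. \<exists>i \<in> {1..t}. \<exists>j \<in> {1..t}. i \<noteq> j \<and> u \<in> pverts (H i) \<and> v \<in> pverts (H j)) \<and>
     G = \<lparr> pverts = (\<Union>i \<in> {1..t}. pverts (H i)), parcs = (\<Union>i \<in> {1..t}. parcs (H i)) \<union> A \<rparr> \<and>
     min_degree G = q \<and>
     (\<forall>i \<in> {1..t}. \<forall>j \<in> {1..t}. i \<noteq> j \<longrightarrow>
        (\<forall>v \<in> pverts (H i). k \<le> card (nbhd G v \<inter> pverts (H j))))"

text \<open>
  Since \<open>q = min_degree G\<close>, the value \<open>q = 0\<close> only concerns \<open>k = 1\<close> and graphs with an isolated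
  vertex. It has to be allowed: such a graph has 1-tuple domatic number
  \<open>1 = \<lfloor>(0 + 1) / 1\<rfloor>\<close>, so the characterization fails for it if \<open>q\<close> must be positive.
  For graphs of positive minimum degree this makes no difference.
\<close>

definition Omega :: "nat \<Rightarrow> 'a pair_pre_digraph set" where
  "Omega k = {G. \<exists>q t r H A. q + 1 = t * k + r \<and> r \<le> k - 1 \<and> omega_construction k q t H A G}"

end

theory Submission
  imports Defs
begin

text \<open>
  A vertex \<open>v\<close> of minimum degree has only \<open>min_degree G + 1\<close> vertices in its closed neighborhood,
  and every class of a partition into \<open>k\<close>-tuple dominating sets takes at least \<open>k\<close> of them. Hence
  no such partition has more than \<open>t = (min_degree G + 1) div k\<close> classes
  (\<open>card_dominating_partition_le\<close>), and the domatic number equals \<open>t\<close> exactly when some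
  partition has \<open>t\<close> classes (\<open>domatic_number_eq_bound_iff\<close>).

  Such partitions and the decompositions defining \<^const>\<open>Omega\<close> are the same data: the parts
  \<open>H i\<close> are the subgraphs induced on the classes. A vertex counts in its own closed neighborhood,
  so \<open>k\<close>-tuple domination by its own class means degree at least \<open>k - 1\<close> in \<open>H i\<close>, while
  domination by any other class means at least \<open>k\<close> neighbors there. The one clause that needs
  an argument is that some part has minimum degree at most \<open>2 * k - 2\<close>: a vertex of minimum
  degree in \<open>G\<close> spends at least \<open>(t - 1) * k\<close> of its \<open>t * k + r\<close> closed neighbors on the other
  classes, which leaves at most \<open>k + r \<le> 2 * k - 1\<close> for its own class.
\<close>

section \<open>Neighborhoods and the minimum degree\<close>

lemma nbhd_subset_pverts:
  assumes "simple_graph G"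
  shows "nbhd G v \<subseteq> pverts G"
proof -
  interpret pair_graph G using assms by (simp add: simple_graph_def)
  show ?thesis by (auto simp: nbhd_def dest: in_arcsD2)
qed

lemma not_in_own_nbhd:
  assumes "simple_graph G"
  shows "v \<notin> nbhd G v"
proof -
  interpret pair_graph G using assms by (simp add: simple_graph_def)
  show ?thesis by (auto simp: nbhd_def dest: pair_no_loops)
qed

lemma sym_parcs:
  assumes "simple_graph G"
  shows "sym (parcs G)"
proof -
  interpret pair_graph G using assms by (simp add: simple_graph_def)
  show ?thesis using pair_sym_arcs by (simp add: symmetric_def)
qed

lemma finite_pverts:
  assumes "simple_graph G"
  shows "finite (pverts G)"
proof -
  interpret pair_graph G using assms by (simp add: simple_graph_def)
  show ?thesis by simp
qed

lemma finite_nbhd: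
  assumes "simple_graph G"
  shows "finite (nbhd G v)"
  using finite_subset[OF nbhd_subset_pverts[OF assms] finite_pverts[OF assms]] .

lemma card_closed_nbhd:
  assumes "simple_graph G"
  shows "card (closed_nbhd G v) = card (nbhd G v) + 1"
  using finite_nbhd[OF assms] not_in_own_nbhd[OF assms] by (simp add: closed_nbhd_def)

lemma min_degree_le:
  assumes "simple_graph G" "v \<in> pverts G"
  shows "min_degree G \<le> card (nbhd G v)"
  using assms(2) finite_pverts[OF assms(1)] by (auto simp: min_degree_def intro: Min_le)

lemma min_degree_attained:
  assumes "simple_graph G"
  obtains v where "v \<in> pverts G" "card (nbhd G v) = min_degree G"
proof -
  have "min_degree G \<in> (\<lambda>v. card (nbhd G v)) ` pverts G"
    unfolding min_degree_def using assms finite_pverts[OF assms]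
    by (intro Min_in) (auto simp: simple_graph_def)
  then show ?thesis using that by auto
qed

section \<open>The size of dominating partitions\<close>

lemma card_closed_nbhd_eq_sum:
  assumes "simple_graph G" "v \<in> pverts G" "partition_on (pverts G) P"
  shows "card (closed_nbhd G v) = (\<Sum>S\<in>P. card (closed_nbhd G v \<inter> S))"
proof -
  have fin: "finite (closed_nbhd G v)"
    using finite_nbhd[OF assms(1)] by (simp add: closed_nbhd_def)
  have "closed_nbhd G v \<subseteq> \<Union>P"
    using assms nbhd_subset_pverts[OF assms(1)] by (auto simp: closed_nbhd_def partition_on_def)
  then have "card (closed_nbhd G v) = card (\<Union>S\<in>P. closed_nbhd G v \<inter> S)"
    by (intro arg_cong[where f = card]) auto
  also have "\<dots> = (\<Sum>S\<in>P. card (closed_nbhd G v \<inter> S))"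
    using finite_elements[OF finite_pverts[OF assms(1)] assms(3)] fin assms(3)
    by (intro card_UN_disjoint) (auto simp: partition_on_def disjoint_def)
  finally show ?thesis .
qed

lemma card_dominating_partition_le:
  assumes "k \<ge> 1" "simple_graph G" "partition_on (pverts G) P"
    and dom: "\<forall>S\<in>P. k_tuple_dominating k G S"
  shows "card P \<le> (min_degree G + 1) div k"
proof -
  obtain v where v: "v \<in> pverts G" "card (nbhd G v) = min_degree G"
    using min_degree_attained[OF assms(2)] .
  have "card P * k \<le> (\<Sum>S\<in>P. card (closed_nbhd G v \<inter> S))"
    using dom v(1) sum_bounded_below[of P k "\<lambda>S. card (closed_nbhd G v \<inter> S)"]
    unfolding k_tuple_dominating_def of_nat_id by blast
  also have "\<dots> = min_degree G + 1"
    using card_closed_nbhd_eq_sum[OF assms(2) v(1) assms(3)] card_closed_nbhd[OF assms(2)] v(2)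
    by simp
  finally show ?thesis
    using assms(1) less_eq_div_iff_mult_less_eq[of k "card P" "min_degree G + 1"] by linarith
qed

text \<open>
  The hypothesis on the minimum degree makes \<open>{pverts G}\<close> a partition into dominating sets, so
  the maximum defining the domatic number is taken over a nonempty set.
\<close>

lemma domatic_number_eq_bound_iff:
  assumes "k \<ge> 1" "simple_graph G" "min_degree G \<ge> k - 1"
  shows "k_tuple_domatic_number k G = (min_degree G + 1) div k \<longleftrightarrow>
    (\<exists>P. partition_on (pverts G) P \<and> (\<forall>S\<in>P. k_tuple_dominating k G S) \<and>
         card P = (min_degree G + 1) div k)"
proof -
  define C where
    "C = {card P | P. partition_on (pverts G) P \<and> (\<forall>S\<in>P. k_tuple_dominating k G S)}"
  have bound: "\<forall>n\<in>C. n \<le> (min_degree G + 1) div k"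
    unfolding C_def using card_dominating_partition_le[OF assms(1,2)] by blast
  then have fin: "finite C"
    using finite_nat_set_iff_bounded_le by blast
  have "k_tuple_dominating k G (pverts G)"
    unfolding k_tuple_dominating_def
  proof (intro conjI ballI)
    fix v assume v: "v \<in> pverts G"
    then have "closed_nbhd G v \<inter> pverts G = closed_nbhd G v"
      using nbhd_subset_pverts[OF assms(2)] by (auto simp: closed_nbhd_def)
    then show "k \<le> card (closed_nbhd G v \<inter> pverts G)"
      using card_closed_nbhd[OF assms(2)] min_degree_le[OF assms(2) v] assms(3)
      by simp
  qed simp
  moreover have "partition_on (pverts G) {pverts G}"
    using assms(2) by (auto simp: partition_on_def simple_graph_def)
  ultimately have "C \<noteq> {}"
    unfolding C_def by blast
  then have "Max C = (min_degree G + 1) div k \<longleftrightarrow> (min_degree G + 1) div k \<in> C"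
    using fin bound by (metis Max_eqI Max_in)
  moreover have "k_tuple_domatic_number k G = Max C"
    by (simp only: k_tuple_domatic_number_def C_def)
  moreover have "n \<in> C \<longleftrightarrow> (\<exists>P. partition_on (pverts G) P \<and>
      (\<forall>S\<in>P. k_tuple_dominating k G S) \<and> card P = n)" for n
    unfolding C_def by blast
  ultimately show ?thesis
    by simp
qed

section \<open>From dominating partitions to the family\<close>

definition induced_on :: "'a pair_pre_digraph \<Rightarrow> 'a set \<Rightarrow> 'a pair_pre_digraph" where
  "induced_on G S = \<lparr> pverts = S, parcs = parcs G \<inter> S \<times> S \<rparr>"

lemma pverts_induced_on [simp]: "pverts (induced_on G S) = S"
  by (simp add: induced_on_def)

lemma nbhd_induced_on: "v \<in> S \<Longrightarrow> nbhd (induced_on G S) v = nbhd G v \<inter> S"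
  by (auto simp: induced_on_def nbhd_def)

lemma simple_graph_induced_on:
  assumes "simple_graph G" "S \<subseteq> pverts G" "S \<noteq> {}"
  shows "simple_graph (induced_on G S)"
proof -
  interpret pair_graph G using assms by (simp add: simple_graph_def)
  have "finite S"
    using finite_subset[OF assms(2) finite_pverts[OF assms(1)]] .
  moreover have "sym (parcs G \<inter> S \<times> S)"
    using pair_sym_arcs by (auto simp: symmetric_def sym_def)
  ultimately have "pair_graph (induced_on G S)"
    by unfold_locales (auto simp: induced_on_def symmetric_def dest: pair_no_loops in_arcsD1 in_arcsD2)
  then show ?thesis using assms(3) by (simp add: simple_graph_def)
qed

text \<open>Inside its own class a vertex dominates itself, which is the source of the \<open>k - 1\<close>.\<close>

lemma card_closed_nbhd_Int_own:
  assumes "simple_graph G" "v \<in> S"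
  shows "card (closed_nbhd G v \<inter> S) = card (nbhd G v \<inter> S) + 1"
proof -
  have "closed_nbhd G v \<inter> S = insert v (nbhd G v \<inter> S)"
    using assms(2) by (auto simp: closed_nbhd_def)
  then show ?thesis
    using finite_nbhd[OF assms(1)] not_in_own_nbhd[OF assms(1)] by simp
qed

lemma closed_nbhd_Int_other: "v \<notin> S \<Longrightarrow> closed_nbhd G v \<inter> S = nbhd G v \<inter> S"
  by (auto simp: closed_nbhd_def)

text \<open>
  This is where maximality of the number of classes enters: with fewer classes the vertex \<open>v\<close>
  could have more neighbors in its own class, but with the full quotient of
  \<open>min_degree G + 1\<close> by \<open>k\<close> the other classes leave it fewer than \<open>2 * k\<close> closed neighbors.
\<close>

lemma card_own_class_le:
  assumes "k \<ge> 1" "simple_graph G" "partition_on (pverts G) P"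
    and dom: "\<forall>S\<in>P. k_tuple_dominating k G S"
    and card_P: "card P = (min_degree G + 1) div k"
    and v: "v \<in> pverts G" "card (nbhd G v) = min_degree G"
    and S: "S \<in> P" "v \<in> S"
  shows "card (nbhd G v \<inter> S) \<le> 2 * k - 2"
proof -
  have fin: "finite P"
    using finite_elements[OF finite_pverts[OF assms(2)] assms(3)] .
  have "card (P - {S}) * k \<le> (\<Sum>T\<in>P - {S}. card (closed_nbhd G v \<inter> T))"
    using dom v(1) sum_bounded_below[of "P - {S}" k "\<lambda>T. card (closed_nbhd G v \<inter> T)"]
    unfolding k_tuple_dominating_def of_nat_id by blast
  moreover have "(\<Sum>T\<in>P. card (closed_nbhd G v \<inter> T)) =
      card (closed_nbhd G v \<inter> S) + (\<Sum>T\<in>P - {S}. card (closed_nbhd G v \<inter> T))"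
    using fin S(1) by (simp add: sum.remove)
  moreover have "(\<Sum>T\<in>P. card (closed_nbhd G v \<inter> T)) = min_degree G + 1"
    using card_closed_nbhd_eq_sum[OF assms(2) v(1) assms(3)] card_closed_nbhd[OF assms(2)] v(2)
    by simp
  moreover have "card P * k = card (P - {S}) * k + k"
    using card.remove[OF fin S(1)] by simp
  moreover have "min_degree G + 1 < card P * k + k"
    using card_P assms(1) dividend_less_div_times[of k "min_degree G + 1"] by simp
  ultimately have "card (closed_nbhd G v \<inter> S) < 2 * k"
    by linarith
  then show ?thesis
    using card_closed_nbhd_Int_own[OF assms(2) S(2)] by linarith
qed

text \<open>
  The parts are the induced subgraphs on the classes and the added edges are all the remaining
  ones, so the parts reassemble to \<open>G\<close>; the clause on a part of small minimum degree holds for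
  the class of a vertex of minimum degree in \<open>G\<close>.
\<close>

lemma Omega_if_dominating_partition:
  assumes "k \<ge> 1" "simple_graph G" "partition_on (pverts G) P"
    and dom: "\<forall>S\<in>P. k_tuple_dominating k G S"
    and card_P: "card P = (min_degree G + 1) div k"
  shows "G \<in> Omega k"
proof -
  define t where "t = card P"
  have "finite P"
    using finite_elements[OF finite_pverts[OF assms(2)] assms(3)] .
  then obtain S where S: "bij_betw S {1..t} P"
    unfolding t_def using ex_bij_betw_nat_finite_1 by blast
  have S_in: "S i \<in> P" if "i \<in> {1..t}" for i
    using bij_betwE[OF S] that by blast
  have S_sub: "S i \<subseteq> pverts G" if "i \<in> {1..t}" for i
    unfolding partition_onD1[OF assms(3)] using S_in[OF that] by (rule Union_upper)
  have S_ne: "S i \<noteq> {}" if "i \<in> {1..t}" for i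
    using partition_onD3[OF assms(3)] S_in[OF that] by metis
  have S_disj: "S i \<inter> S j = {}" if "i \<in> {1..t}" "j \<in> {1..t}" "i \<noteq> j" for i j
  proof -
    have "S i \<noteq> S j" using inj_onD[OF bij_betw_imp_inj_on[OF S]] that by blast
    then show ?thesis
      using disjointD[OF partition_onD2[OF assms(3)] S_in[OF that(1)] S_in[OF that(2)]] by blast
  qed
  have S_cover: "(\<Union>i\<in>{1..t}. S i) = pverts G"
    using bij_betw_imp_surj_on[OF S] partition_onD1[OF assms(3)] by simp
  have S_dom: "k \<le> card (closed_nbhd G v \<inter> S i)" if "i \<in> {1..t}" "v \<in> pverts G" for i v
    using dom S_in[OF that(1)] that(2) unfolding k_tuple_dominating_def by blast
  define H where "H i = induced_on G (S i)" for i
  define A where "A = parcs G - (\<Union>i\<in>{1..t}. S i \<times> S i)"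
  have H_simple: "simple_graph (H i)" if "i \<in> {1..t}" for i
    unfolding H_def using simple_graph_induced_on[OF assms(2) S_sub S_ne] that by blast
  have H_deg: "min_degree (H i) \<ge> k - 1" if i: "i \<in> {1..t}" for i
  proof -
    obtain v where v: "v \<in> S i" "card (nbhd (H i) v) = min_degree (H i)"
      using min_degree_attained[OF H_simple[OF i]] by (auto simp: H_def)
    have "k \<le> card (closed_nbhd G v \<inter> S i)"
      using S_dom[OF i] S_sub[OF i] v(1) by blast
    then show ?thesis
      using card_closed_nbhd_Int_own[OF assms(2) v(1)] nbhd_induced_on[OF v(1), of G] v(2)
      by (simp add: H_def)
  qed
  have small: "\<exists>i\<in>{1..t}. min_degree (H i) \<le> 2 * k - 2"
  proof -
    obtain v where v: "v \<in> pverts G" "card (nbhd G v) = min_degree G"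
      using min_degree_attained[OF assms(2)] .
    then obtain i where i: "i \<in> {1..t}" "v \<in> S i"
      using S_cover by blast
    have "min_degree (H i) \<le> card (nbhd (H i) v)"
      using min_degree_le[OF H_simple[OF i(1)]] i(2) by (simp add: H_def)
    also have "\<dots> = card (nbhd G v \<inter> S i)"
      using nbhd_induced_on[OF i(2)] by (simp add: H_def)
    also have "\<dots> \<le> 2 * k - 2"
      using card_own_class_le[OF assms v S_in[OF i(1)] i(2)] .
    finally show ?thesis using i(1) by blast
  qed
  have A_cross: "\<exists>i\<in>{1..t}. \<exists>j\<in>{1..t}. i \<noteq> j \<and> u \<in> S i \<and> w \<in> S j" if "(u, w) \<in> A" for u w
  proof -
    have "w \<in> nbhd G u" "u \<in> nbhd G w"
      using that symD[OF sym_parcs[OF assms(2)]] by (auto simp: A_def nbhd_def)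
    then have "u \<in> pverts G" "w \<in> pverts G"
      using nbhd_subset_pverts[OF assms(2)] by blast+
    then obtain i j where "i \<in> {1..t}" "j \<in> {1..t}" "u \<in> S i" "w \<in> S j"
      using S_cover by blast
    moreover from this have "i \<noteq> j" using that by (auto simp: A_def)
    ultimately show ?thesis by blast
  qed
  have "sym A"
    using symD[OF sym_parcs[OF assms(2)]] unfolding A_def by (intro symI) blast
  moreover have "G = \<lparr> pverts = (\<Union>i\<in>{1..t}. S i),
      parcs = (\<Union>i\<in>{1..t}. parcs (H i)) \<union> A \<rparr>"
    unfolding S_cover by (intro pair_pre_digraph.equality) (auto simp: H_def A_def induced_on_def)
  moreover have "k \<le> card (nbhd G v \<inter> S j)"
    if "i \<in> {1..t}" "j \<in> {1..t}" "i \<noteq> j" "v \<in> S i" for i j v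
  proof -
    have "v \<notin> S j" "v \<in> pverts G" using S_disj S_sub that by blast+
    then show ?thesis
      using S_dom[OF that(2), of v] closed_nbhd_Int_other[of v "S j" G] by simp
  qed
  ultimately have "omega_construction k (min_degree G) t H A G"
    unfolding omega_construction_def using H_simple H_deg small A_cross S_disj
    by (auto simp: disjoint_family_on_def H_def)
  moreover have "min_degree G + 1 = t * k + (min_degree G + 1) mod k"
    unfolding t_def card_P by simp
  moreover have "(min_degree G + 1) mod k \<le> k - 1"
    using assms(1) mod_less_divisor[of k "min_degree G + 1"] by linarith
  ultimately show ?thesis unfolding Omega_def by blast
qed

section \<open>From the family to dominating partitions, and the characterization\<close>

text \<open>
  The classes are the vertex sets of the parts \<open>H i\<close>. Adding cross edges removes no neighbor
  inside a part, so every part still dominates itself; the other parts dominate by the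
  cross-edge condition. Since \<open>q + 1 = t * k + r\<close> is a division with remainder, the number
  \<open>t\<close> of parts is the quotient.
\<close>

lemma dominating_partition_if_Omega:
  assumes "k \<ge> 1" "simple_graph G" "G \<in> Omega k"
  shows "\<exists>P. partition_on (pverts G) P \<and> (\<forall>S\<in>P. k_tuple_dominating k G S) \<and>
    card P = (min_degree G + 1) div k"
proof -
  obtain q t r H A where eq: "q + 1 = t * k + r" "r \<le> k - 1"
    and con: "omega_construction k q t H A G"
    using assms(3) by (auto simp: Omega_def)
  note con = con[unfolded omega_construction_def]
  have H_simple: "simple_graph (H i)" and H_deg: "min_degree (H i) \<ge> k - 1" if "i \<in> {1..t}" for i
    using con that by simp_all
  have G: "G = \<lparr> pverts = (\<Union>i\<in>{1..t}. pverts (H i)),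
      parcs = (\<Union>i\<in>{1..t}. parcs (H i)) \<union> A \<rparr>"
    using con by (elim conjE)
  have verts: "pverts G = (\<Union>i\<in>{1..t}. pverts (H i))"
    by (subst G) simp
  have arcs: "(\<Union>i\<in>{1..t}. parcs (H i)) \<subseteq> parcs G"
    by (subst G) simp
  have disj: "disjoint_family_on (\<lambda>i. pverts (H i)) {1..t}"
    using con by (elim conjE)
  have q: "min_degree G = q"
    using con by (elim conjE)
  have cross: "\<forall>i\<in>{1..t}. \<forall>j\<in>{1..t}. i \<noteq> j \<longrightarrow>
      (\<forall>v\<in>pverts (H i). k \<le> card (nbhd G v \<inter> pverts (H j)))"
    using con by (elim conjE)
  define P where "P = (\<lambda>i. pverts (H i)) ` {1..t}"
  have H_ne: "pverts (H i) \<noteq> {}" if "i \<in> {1..t}" for i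
    using H_simple[OF that] by (simp add: simple_graph_def)
  have "inj_on (\<lambda>i. pverts (H i)) {1..t}"
    using disj H_ne by (fastforce simp: inj_on_def disjoint_family_on_def)
  then have "card P = t"
    unfolding P_def by (simp add: card_image)
  also have "t = (min_degree G + 1) div k"
    using eq q assms(1) by (simp add: div_nat_eqI algebra_simps)
  finally have "card P = (min_degree G + 1) div k" .
  moreover have "partition_on (pverts G) P"
    unfolding partition_on_def P_def
  proof (intro conjI disjointI)
    show "\<Union>((\<lambda>i. pverts (H i)) ` {1..t}) = pverts G" using verts by simp
    show "{} \<notin> (\<lambda>i. pverts (H i)) ` {1..t}" using H_ne by (metis imageE)
    show "p \<inter> q = {}" if pq: "p \<in> (\<lambda>i. pverts (H i)) ` {1..t}"
      "q \<in> (\<lambda>i. pverts (H i)) ` {1..t}" "p \<noteq> q" for p q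
    proof -
      obtain i j where "i \<in> {1..t}" "j \<in> {1..t}" "p = pverts (H i)" "q = pverts (H j)"
        using pq(1,2) by (elim imageE)
      moreover from this pq(3) have "i \<noteq> j" by metis
      ultimately show ?thesis using disjoint_family_onD[OF disj] by simp
    qed
  qed
  moreover have "k_tuple_dominating k G (pverts (H j))" if j: "j \<in> {1..t}" for j
    unfolding k_tuple_dominating_def
  proof (intro conjI ballI)
    show "pverts (H j) \<subseteq> pverts G" using verts j by blast
  next
    fix v assume "v \<in> pverts G"
    then obtain i where i: "i \<in> {1..t}" "v \<in> pverts (H i)" using verts by blast
    show "k \<le> card (closed_nbhd G v \<inter> pverts (H j))"
    proof (cases "i = j")
      case True
      then have H_v: "v \<in> pverts (H j)" using i(2) by simp
      have "parcs (H j) \<subseteq> parcs G" using arcs j by (simp add: UN_subset_iff)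
      then have "nbhd (H j) v \<subseteq> nbhd G v \<inter> pverts (H j)"
        using nbhd_subset_pverts[OF H_simple[OF j]] unfolding nbhd_def by fast
      then have "card (nbhd (H j) v) \<le> card (nbhd G v \<inter> pverts (H j))"
        using finite_nbhd[OF assms(2)] by (intro card_mono) auto
      then show ?thesis
        using min_degree_le[OF H_simple[OF j] H_v] H_deg[OF j]
          card_closed_nbhd_Int_own[OF assms(2) H_v]
        by linarith
    next
      case False
      then have "v \<notin> pverts (H j)"
        using disjoint_family_onD[OF disj i(1) j False] i(2) by blast
      then show ?thesis
        using cross i j False closed_nbhd_Int_other[of v "pverts (H j)" G] by simp
    qed
  qed
  ultimately show ?thesis unfolding P_def by blast
qed

theorem theorem2p1:
  fixes k :: nat and G :: "'a pair_pre_digraph"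
  assumes "k \<ge> 1"
    and "simple_graph G"
    and "min_degree G \<ge> k - 1"
  shows "int (k_tuple_domatic_number k G) = \<lfloor>real (min_degree G + 1) / real k\<rfloor> \<longleftrightarrow> G \<in> Omega k"
proof -
  have "\<lfloor>real (min_degree G + 1) / real k\<rfloor> = int ((min_degree G + 1) div k)"
    by (rule floor_divide_of_nat_eq)
  then have "int (k_tuple_domatic_number k G) = \<lfloor>real (min_degree G + 1) / real k\<rfloor> \<longleftrightarrow>
      k_tuple_domatic_number k G = (min_degree G + 1) div k"
    by (simp only: of_nat_eq_iff)
  then show ?thesis
    using domatic_number_eq_bound_iff[OF assms] Omega_if_dominating_partition[OF assms(1,2)]
      dominating_partition_if_Omega[OF assms(1,2)]
    by blast
qed

end
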